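(* Let $\Omega=\{(\xi,\eta,\zeta)\in\mathbb R^3:\ \xi,\eta,\zeta\ge 0,\ \xi\le 1-\zeta,\ \eta\le 1-\zeta\}$ and define $u:\Omega\to\mathbb R$ by $$u(\xi,\eta,\zeta)=\frac{\xi\,\zeta\,(\xi+\zeta-1)(\eta+\zeta-1)}{1-\zeta}.$$ Then: (1) $u\in H^1(\Omega)$; (2) the restriction (trace) of $u$ to each of the five faces of $\Omega$ is a polynomial; (3) there is no polynomial $p\in\mathbb R[\xi,\eta,\zeta]$ which agrees with $u$ on every face of $\Omega$.
   Context: $\Omega$ is a pyramid with square base $\{\zeta=0\}$, triangular faces in the planes $\eta=0$, $\xi=1-\zeta$, $\eta=1-\zeta$, $\xi=0$, and apex $(0,0,1)$. The formula for $u$ is understood away from the apex, and $u$ extends by continuity with value $0$ there. *)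

theory Defs
  imports "HOL-Analysis.Analysis"
begin

subsection \<open>The Sobolev space \<open>H\<^sup>1\<close>\<close>

text \<open>
  \<open>C_k k f\<close>: all iterated partial derivatives of \<open>f\<close> of order less than \<open>k\<close> are differentiable, and
  those of order \<open>k\<close> are continuous. Here \<open>frechet_derivative f (at x) i\<close> is the partial derivative
  of \<open>f\<close> at \<open>x\<close> in the direction of the basis vector \<open>i\<close>.
\<close>

primrec C_k :: "nat \<Rightarrow> ('a::euclidean_space \<Rightarrow> real) \<Rightarrow> bool" where
  "C_k 0 f \<longleftrightarrow> continuous_on UNIV f"
| "C_k (Suc k) f \<longleftrightarrow>
     f differentiable_on UNIV \<and> (\<forall>i\<in>Basis. C_k k (\<lambda>x. frechet_derivative f (at x) i))"

text \<open>Elements of \<open>C\<^sub>c\<^sup>\<infinity>(U)\<close>, extended by zero to the whole space.\<close>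

definition test_function_on :: "'a::euclidean_space set \<Rightarrow> ('a \<Rightarrow> real) \<Rightarrow> bool" where
  "test_function_on U \<phi> \<longleftrightarrow>
     (\<forall>k. C_k k \<phi>) \<and> compact (closure {x. \<phi> x \<noteq> 0}) \<and> closure {x. \<phi> x \<noteq> 0} \<subseteq> U"

definition L2_on :: "'a::euclidean_space set \<Rightarrow> ('a \<Rightarrow> real) set" where
  "L2_on U = {f. f \<in> borel_measurable (lebesgue_on U) \<and> integrable (lebesgue_on U) (\<lambda>x. (f x)\<^sup>2)}"

text \<open>
  The two integrands below are integrable whenever \<open>f\<close> and \<open>g\<close> are locally integrable on \<open>U\<close>; in
  \<open>H1_on\<close> both are in \<open>L2_on U\<close>, so that the convention for integrals of non-integrable functions
  plays no role.
\<close>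

definition weak_partial_derivative_on ::
    "'a::euclidean_space set \<Rightarrow> 'a \<Rightarrow> ('a \<Rightarrow> real) \<Rightarrow> ('a \<Rightarrow> real) \<Rightarrow> bool" where
  "weak_partial_derivative_on U i f g \<longleftrightarrow>
     (\<forall>\<phi>. test_function_on U \<phi> \<longrightarrow>
        (LINT x|lebesgue_on U. f x * frechet_derivative \<phi> (at x) i)
          = - (LINT x|lebesgue_on U. g x * \<phi> x))"

text \<open>\<open>U\<close> is meant to be open; elements are functions rather than classes modulo null sets.\<close>

definition H1_on :: "'a::euclidean_space set \<Rightarrow> ('a \<Rightarrow> real) set" where
  "H1_on U = {f \<in> L2_on U. \<forall>i\<in>Basis. \<exists>g\<in>L2_on U. weak_partial_derivative_on U i f g}"


subsection \<open>The pyramid and the function \<open>u\<close>\<close>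

text \<open>The coordinates \<open>\<xi>\<close>, \<open>\<eta>\<close>, \<open>\<zeta>\<close> of \<open>x\<close> are \<open>x $ 1\<close>, \<open>x $ 2\<close>, \<open>x $ 3\<close>.\<close>

definition pyramid :: "(real ^ 3) set" where
  "pyramid = {x. x $ 1 \<ge> 0 \<and> x $ 2 \<ge> 0 \<and> x $ 3 \<ge> 0 \<and> x $ 1 \<le> 1 - x $ 3 \<and> x $ 2 \<le> 1 - x $ 3}"

definition pyramid_faces :: "(real ^ 3) set set" where
  "pyramid_faces =
     {pyramid \<inter> {x. x $ 3 = 0},
      pyramid \<inter> {x. x $ 2 = 0},
      pyramid \<inter> {x. x $ 1 = 1 - x $ 3},
      pyramid \<inter> {x. x $ 2 = 1 - x $ 3},
      pyramid \<inter> {x. x $ 1 = 0}}"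

definition apex :: "real ^ 3" where
  "apex = vector [0, 0, 1]"

definition pyramid_u :: "real ^ 3 \<Rightarrow> real" where
  "pyramid_u x =
     (if x = apex then 0
      else x $ 1 * x $ 3 * (x $ 1 + x $ 3 - 1) * (x $ 2 + x $ 3 - 1) / (1 - x $ 3))"

lemma apex_in_pyramid: "apex \<in> pyramid"
  by (simp add: pyramid_def apex_def)

lemma pyramid_eq_apex_iff:
  assumes "x \<in> pyramid"
  shows "x = apex \<longleftrightarrow> x $ 3 = 1"
  using assms by (auto simp: pyramid_def apex_def vec_eq_iff forall_3)

lemma abs_pyramid_u_le:
  assumes "x \<in> pyramid"
  shows "\<bar>pyramid_u x\<bar> \<le> 1 - x $ 3"
proof (cases "x = apex")
  case True
  then show ?thesis by (simp add: pyramid_u_def apex_def)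
next
  case False
  define a b c where "a = x $ 1" and "b = x $ 2" and "c = x $ 3"
  have h: "0 \<le> a" "0 \<le> b" "0 \<le> c" "a \<le> 1 - c" "b \<le> 1 - c"
    using assms unfolding pyramid_def a_def b_def c_def by simp_all
  have "c \<noteq> 1"
    using False pyramid_eq_apex_iff[OF assms] unfolding c_def by simp
  then have c: "0 < 1 - c"
    using h by linarith
  have 1: "\<bar>a * c\<bar> \<le> (1 - c) * 1"
    unfolding abs_mult by (rule mult_mono; use h in \<open>simp add: abs_le_iff\<close>)
  have 2: "\<bar>a * c * (a + c - 1)\<bar> \<le> (1 - c) * 1 * 1"
    unfolding abs_mult[of "a * c"] by (rule mult_mono[OF 1]; use h in \<open>simp add: abs_le_iff\<close>)
  have "\<bar>a * c * (a + c - 1) * (b + c - 1)\<bar> \<le> (1 - c) * 1 * 1 * (1 - c)"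
    unfolding abs_mult[of _ "b + c - 1"] by (rule mult_mono[OF 2]; use h in \<open>simp add: abs_le_iff\<close>)
  then have "\<bar>a * c * (a + c - 1) * (b + c - 1)\<bar> / (1 - c) \<le> 1 - c"
    using c by (simp only: pos_divide_le_eq mult_1_right)
  moreover have "pyramid_u x = a * c * (a + c - 1) * (b + c - 1) / (1 - c)"
    using False by (simp add: pyramid_u_def a_def b_def c_def)
  ultimately show ?thesis
    using c by (simp only: abs_divide abs_of_pos c_def)
qed

text \<open>
  The value \<open>0\<close> at the apex is the continuous extension. Hence the trace of \<open>pyramid_u\<close> on a face is
  its restriction to that face.
\<close>

lemma continuous_on_pyramid_u: "continuous_on pyramid pyramid_u"
  unfolding continuous_on_eq_continuous_within
proof
  fix x assume x: "x \<in> pyramid"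
  show "continuous (at x within pyramid) pyramid_u"
  proof (cases "x = apex")
    case True
    have "((\<lambda>y. 1 - y $ 3) \<longlongrightarrow> 1 - x $ 3) (at x within pyramid)"
      by (intro tendsto_intros)
    then have "((\<lambda>y. 1 - y $ 3) \<longlongrightarrow> 0) (at x within pyramid)"
      using True by (simp add: apex_def)
    then have "(pyramid_u \<longlongrightarrow> 0) (at x within pyramid)"
      by (rule Lim_null_comparison[rotated])
         (auto simp: eventually_at_filter abs_pyramid_u_le)
    then show ?thesis
      using True by (simp add: continuous_within pyramid_u_def)
  next
    case False
    then have "x $ 3 \<noteq> 1"
      using x pyramid_eq_apex_iff by blast
    then have lim: "((\<lambda>x. x $ 1 * x $ 3 * (x $ 1 + x $ 3 - 1) * (x $ 2 + x $ 3 - 1) / (1 - x $ 3))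
        \<longlongrightarrow> x $ 1 * x $ 3 * (x $ 1 + x $ 3 - 1) * (x $ 2 + x $ 3 - 1) / (1 - x $ 3))
        (at x within pyramid)"
      by (intro tendsto_intros) auto
    have "eventually (\<lambda>y. y \<noteq> apex) (at x within pyramid)"
      using False tendsto_imp_eventually_ne[OF tendsto_ident_at] by blast
    then have "eventually (\<lambda>y.
        y $ 1 * y $ 3 * (y $ 1 + y $ 3 - 1) * (y $ 2 + y $ 3 - 1) / (1 - y $ 3) = pyramid_u y)
        (at x within pyramid)"
      by (rule eventually_mono) (simp only: pyramid_u_def if_False)
    then have "(pyramid_u \<longlongrightarrow> x $ 1 * x $ 3 * (x $ 1 + x $ 3 - 1) * (x $ 2 + x $ 3 - 1) / (1 - x $ 3))
        (at x within pyramid)"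
      by (rule Lim_transform_eventually[OF lim])
    then show ?thesis
      using False by (simp add: continuous_within pyramid_u_def)
  qed
qed

end

theory Submission
  imports Defs
begin

text \<open>
  The partial derivatives of \<open>u\<close> are bounded on the interior of the pyramid, since
  \<open>\<xi> / (1 - \<zeta>)\<close> and \<open>\<eta> / (1 - \<zeta>)\<close> lie between \<open>0\<close> and \<open>1\<close> there. They are the weak derivatives
  because the integral of a directional derivative of a compactly supported function vanishes, by
  translation invariance of Lebesgue measure.

  For the last claim, expand \<open>p\<close> at the apex. With \<open>a = 1 - \<zeta>\<close>, the part of degree two is a quadratic
  form in \<open>\<xi>\<close>, \<open>\<eta>\<close>, \<open>a\<close> that vanishes on the planes \<open>\<xi> = 0\<close>, \<open>\<xi> = a\<close> and \<open>\<eta> = a\<close>, hence is zero.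
  On the face \<open>\<eta> = 0\<close>, however, \<open>u = \<xi> (1 - a) (a - \<xi>)\<close> has the part \<open>\<xi> (a - \<xi>)\<close> of degree two.
\<close>

subsection \<open>Classical derivatives as weak derivatives\<close>

text \<open>The difference quotients of \<open>g\<close> along \<open>e\<close> integrate to zero,
  because \<open>g\<close> and its translates have the same integral. They tend to \<open>D\<close>,
  and the mean value theorem bounds them by a bound for \<open>D\<close>, so dominated convergence
  passes to the limit.\<close>

lemma integral_directional_derivative_eq_0:
  fixes g D :: "'a::euclidean_space \<Rightarrow> real"
  assumes g: "continuous_on UNIV g" and D: "continuous_on UNIV D"
    and bdd: "bounded {x. g x \<noteq> 0}"
    and deriv: "\<And>x. ((\<lambda>t. g (x + t *\<^sub>R e)) has_real_derivative D x) (at 0)"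
  shows "(LINT x|lborel. D x) = 0"
proof -
  obtain R where R: "\<And>x. g x \<noteq> 0 \<Longrightarrow> norm x \<le> R"
    using bdd unfolding bounded_iff by auto
  have D0: "D x = 0" if "norm x > R" for x
  proof -
    have "((\<lambda>t. norm (x + t *\<^sub>R e)) \<longlongrightarrow> norm (x + 0 *\<^sub>R e)) (nhds 0)"
      by (intro tendsto_intros filterlim_ident)
    then have "eventually (\<lambda>t. norm (x + t *\<^sub>R e) > R) (nhds 0)"
      using that by (intro order_tendstoD(1)) auto
    then have "eventually (\<lambda>t. g (x + t *\<^sub>R e) = 0) (nhds 0)"
      by eventually_elim (use R in force)
    then have "((\<lambda>t. g (x + t *\<^sub>R e)) has_real_derivative 0) (at 0)"
      by (subst DERIV_cong_ev[OF refl _ refl, where g = "\<lambda>_. 0"]) auto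
    with deriv[of x] show ?thesis by (rule DERIV_unique)
  qed
  obtain M where M: "\<And>x. norm x \<le> R \<Longrightarrow> \<bar>D x\<bar> \<le> M"
  proof -
    have "compact (D ` cball 0 R)"
      by (intro compact_continuous_image compact_cball continuous_on_subset[OF D]) auto
    then have "bounded (D ` cball 0 R)"
      by (rule compact_imp_bounded)
    then obtain M where "\<forall>y\<in>D ` cball 0 R. norm y \<le> M"
      unfolding bounded_iff by blast
    then show ?thesis
      by (intro that[of M]) simp
  qed
  \<comment> \<open>Taking \<open>max M 0\<close> covers \<open>R < 0\<close>, where the ball is
    empty and \<open>M\<close> may be negative.\<close>
  have M': "\<bar>D x\<bar> \<le> max M 0" for x
    using M[of x] D0[of x] by (cases "norm x \<le> R") (auto simp: max_def)
  define h :: "nat \<Rightarrow> real" where "h n = inverse (real (Suc n))" for n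
  have h: "0 < h n" "h n \<le> 1" for n by (auto simp: h_def field_simps)
  define s where "s n x = (g (x + h n *\<^sub>R e) - g x) / h n" for n x
  \<comment> \<open>As \<open>h n\<close> is at most 1, the shift moves a point by at most
    \<open>norm e\<close>; outside this ball both values of \<open>g\<close> in \<open>s n x\<close>
    vanish.\<close>
  define B where "B = cball (0::'a) (R + norm e)"
  have deriv': "((\<lambda>t. g (x + t *\<^sub>R e)) has_real_derivative D (x + t *\<^sub>R e)) (at t)" for x t
    using deriv[of "x + t *\<^sub>R e"] DERIV_shift[of "\<lambda>t. g (x + t *\<^sub>R e)" _ 0 t]
    by (simp add: algebra_simps)
  have s_le: "\<bar>s n x\<bar> \<le> max M 0" for n x
  proof -
    obtain z where "g (x + h n *\<^sub>R e) - g (x + 0 *\<^sub>R e) = (h n - 0) * D (x + z *\<^sub>R e)"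
      using MVT2[of 0 "h n" "\<lambda>t. g (x + t *\<^sub>R e)" "\<lambda>t. D (x + t *\<^sub>R e)"] h deriv' by blast
    then have "s n x = D (x + z *\<^sub>R e)"
      using h[of n] by (simp add: s_def)
    then show ?thesis using M' by simp
  qed
  have s0: "s n x = 0" if "x \<notin> B" for n x
  proof -
    have "norm x > R + norm e" using that by (simp add: B_def)
    moreover have "norm x \<le> norm (x + h n *\<^sub>R e) + norm (h n *\<^sub>R e)"
      by (metis add_diff_cancel norm_triangle_ineq4)
    moreover have "norm (h n *\<^sub>R e) \<le> norm e"
      using h[of n] by (simp add: mult_left_le_one_le)
    ultimately have "norm (x + h n *\<^sub>R e) > R" "norm x > R"
      using norm_ge_zero[of e] by linarith+
    then have "g (x + h n *\<^sub>R e) = 0" "g x = 0" using R by force+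
    then show ?thesis by (simp add: s_def)
  qed
  have [measurable]: "g \<in> borel_measurable borel" "D \<in> borel_measurable borel"
    using g D by (auto intro: borel_measurable_continuous_onI)
  have "(\<lambda>n. LINT x|lborel. s n x) \<longlonglongrightarrow> (LINT x|lborel. D x)"
  proof (rule integral_dominated_convergence[where w = "\<lambda>x. indicator B x *\<^sub>R max M 0"])
    show "integrable lborel (\<lambda>x. indicator B x *\<^sub>R max M 0)"
      unfolding B_def by (intro borel_integrable_compact) auto
    show "AE x in lborel. (\<lambda>n. s n x) \<longlonglongrightarrow> D x"
    proof (rule AE_I2)
      fix x
      have "((\<lambda>t. (g (x + t *\<^sub>R e) - g x) / t) \<longlongrightarrow> D x) (at 0)"
        using deriv[of x] unfolding DERIV_def by simp
      moreover have "filterlim h (at 0) sequentially"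
        unfolding filterlim_at
        using LIMSEQ_inverse_real_of_nat h by (auto simp: h_def[abs_def])
      ultimately show "(\<lambda>n. s n x) \<longlonglongrightarrow> D x"
        unfolding s_def by (rule filterlim_compose)
    qed
    show "AE x in lborel. norm (s n x) \<le> indicator B x *\<^sub>R max M 0" for n
      using s_le s0 by (auto simp: indicator_def)
  qed (auto simp: s_def)
  moreover have "(LINT x|lborel. s n x) = 0" for n
  proof -
    have "integrable lborel (\<lambda>x. indicator (cball 0 R) x *\<^sub>R g x)"
      by (intro borel_integrable_compact continuous_on_subset[OF g]) auto
    also have "(\<lambda>x. indicator (cball 0 R) x *\<^sub>R g x) = g"
      using R by (force simp: indicator_def)
    finally have g_int: "integrable lborel g" .
    have eq: "distr lborel borel ((+) (h n *\<^sub>R e)) = (lborel :: 'a measure)"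
      by (rule lborel_distr_plus)
    have "integrable lborel (\<lambda>x. g (h n *\<^sub>R e + x))"
      using g_int by (subst (asm) eq[symmetric], subst (asm) integrable_distr_eq) auto
    moreover have "(LINT x|lborel. g (h n *\<^sub>R e + x)) = (LINT x|lborel. g x)"
      by (subst (2) eq[symmetric], subst integral_distr) auto
    ultimately show ?thesis
      using g_int by (simp add: s_def add.commute)
  qed
  ultimately show ?thesis
    by (simp add: LIMSEQ_const_iff)
qed

text \<open>The open sets \<open>U\<close> and \<open>- K\<close> cover the space, and
  \<open>f\<close> is continuous on each.\<close>

lemma continuous_on_extend_by_zero:
  fixes f :: "'a::topological_space \<Rightarrow> real"
  assumes "open U" "continuous_on U f" "closed K" "K \<subseteq> U" "\<And>x. x \<notin> K \<Longrightarrow> f x = 0"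
  shows "continuous_on UNIV f"
proof -
  have "continuous_on (- K) f"
    using assms(5) by (subst continuous_on_cong[OF refl, where g = "\<lambda>_. 0"]) auto
  then have "continuous_on (U \<union> - K) f"
    using assms by (intro continuous_on_open_Un) auto
  moreover have "U \<union> - K = UNIV" using assms by auto
  ultimately show ?thesis by simp
qed

text \<open>Weak derivatives are stated over \<open>lebesgue_on U\<close>, whereas translation
  invariance is used for \<open>lborel\<close>. Vanishing off \<open>U\<close> removes the
  restriction, and Borel measurability removes the completion.\<close>

lemma integral_lebesgue_on_eq_lborel:
  fixes f :: "'a::euclidean_space \<Rightarrow> real"
  assumes "U \<in> sets lebesgue" "f \<in> borel_measurable borel" "\<And>x. x \<notin> U \<Longrightarrow> f x = 0"
  shows "(LINT x|lebesgue_on U. f x) = (LINT x|lborel. f x)"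
proof -
  have "(LINT x|lebesgue_on U. f x) = (LINT x|lebesgue. f x)"
    using assms by (subst integral_restrict_space)
      (auto intro!: Bochner_Integration.integral_cong simp: set_lebesgue_integral_def indicator_def)
  also have "\<dots> = (LINT x|lborel. f x)"
    using assms by (intro integral_completion) simp
  finally show ?thesis .
qed

text \<open>For a test function \<phi> with derivative \<open>d\<close> along \<open>i\<close>, the
  product \<open>f * \<phi>\<close> extends by zero and has the continuous derivative
  \<open>f * d + g * \<phi>\<close> along \<open>i\<close>. Its integral vanishes by
  \<open>integral_directional_derivative_eq_0\<close>.\<close>

lemma weak_partial_derivative_onI:
  fixes f g :: "'a::euclidean_space \<Rightarrow> real"
  assumes U: "open U" and f: "continuous_on U f" and g: "continuous_on U g" and i: "i \<in> Basis"
    and deriv: "\<And>x. x \<in> U \<Longrightarrow> ((\<lambda>t. f (x + t *\<^sub>R i)) has_real_derivative g x) (at 0)"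
  shows "weak_partial_derivative_on U i f g"
  unfolding weak_partial_derivative_on_def
proof (intro allI impI)
  fix \<phi> :: "'a \<Rightarrow> real"
  assume \<phi>: "test_function_on U \<phi>"
  define K where "K = closure {x. \<phi> x \<noteq> 0}"
  define d where "d x = frechet_derivative \<phi> (at x) i" for x
  have K: "compact K" "closed K" "K \<subseteq> U"
    using \<phi> by (auto simp: test_function_on_def K_def)
  have "C_k (Suc 0) \<phi>"
    using \<phi> unfolding test_function_on_def by blast
  then have diff: "\<And>x. \<phi> differentiable (at x)" and d: "continuous_on UNIV d"
    using i by (auto simp: differentiable_on_def d_def[abs_def])
  have \<phi>_cont: "continuous_on UNIV \<phi>"
    using diff by (simp add: continuous_on_eq_continuous_at differentiable_imp_continuous_within)
  have \<phi>0: "\<phi> x = 0" if "x \<notin> K" for x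
    using that closure_subset[of "{x. \<phi> x \<noteq> 0}"] by (auto simp: K_def)
  have \<phi>_deriv: "((\<lambda>t. \<phi> (x + t *\<^sub>R i)) has_real_derivative d x) (at 0)" for x
  proof -
    have "(\<phi> has_derivative frechet_derivative \<phi> (at x)) (at (x + 0 *\<^sub>R i))"
      using diff[of x] by (simp add: frechet_derivative_works)
    moreover have "((\<lambda>t. x + t *\<^sub>R i) has_derivative (\<lambda>t. t *\<^sub>R i)) (at 0)"
      by (auto intro!: derivative_eq_intros)
    ultimately have "((\<lambda>t. \<phi> (x + t *\<^sub>R i)) has_derivative
        (\<lambda>t. frechet_derivative \<phi> (at x) (t *\<^sub>R i))) (at 0)"
      by (rule has_derivative_compose[rotated])
    moreover have "linear (frechet_derivative \<phi> (at x))"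
      using diff by (rule linear_frechet_derivative)
    ultimately show ?thesis
      unfolding has_field_derivative_def d_def by (simp add: linear_cmul mult_commute_abs)
  qed
  have ev0: "eventually (\<lambda>t. \<phi> (x + t *\<^sub>R i) = 0) (nhds 0)" if "x \<notin> K" for x
  proof -
    have "((\<lambda>t. x + t *\<^sub>R i) \<longlongrightarrow> x + 0 *\<^sub>R i) (nhds 0)"
      by (intro tendsto_intros filterlim_ident)
    then have "eventually (\<lambda>t. x + t *\<^sub>R i \<in> - K) (nhds 0)"
      using that K(2) by (intro topological_tendstoD) auto
    then show ?thesis by eventually_elim (use \<phi>0 in auto)
  qed
  have d0: "d x = 0" if "x \<notin> K" for x
  proof -
    have "((\<lambda>t. \<phi> (x + t *\<^sub>R i)) has_real_derivative 0) (at 0)"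
      using ev0[OF that] by (subst DERIV_cong_ev[OF refl _ refl, where g = "\<lambda>_. 0"]) auto
    with \<phi>_deriv show ?thesis by (rule DERIV_unique)
  qed
  \<comment> \<open>Nothing is known about \<open>k\<close> outside \<open>U\<close>; the factor
    \<open>m\<close>, which vanishes off \<open>K\<close>, makes the product continuous
    everywhere.\<close>
  have cont_mult: "continuous_on UNIV (\<lambda>x. k x * m x)"
    if "continuous_on U k" "continuous_on UNIV m" "\<And>x. x \<notin> K \<Longrightarrow> m x = 0" for k m :: "'a \<Rightarrow> real"
  proof (rule continuous_on_extend_by_zero[OF U _ K(2,3)])
    show "continuous_on U (\<lambda>x. k x * m x)"
      by (intro continuous_on_mult that continuous_on_subset[OF that(2)]) simp
  qed (simp add: that)
  have cont: "continuous_on UNIV (\<lambda>x. f x * \<phi> x)" "continuous_on UNIV (\<lambda>x. f x * d x)"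
    "continuous_on UNIV (\<lambda>x. g x * \<phi> x)"
    by (simp_all add: cont_mult f g d \<phi>_cont \<phi>0 d0)
  have int: "integrable lborel k"
    if "continuous_on UNIV k" "\<And>x. x \<notin> K \<Longrightarrow> k x = 0" for k :: "'a \<Rightarrow> real"
  proof -
    have "integrable lborel (\<lambda>x. indicator K x *\<^sub>R k x)"
      by (intro borel_integrable_compact K continuous_on_subset[OF that(1)]) auto
    also have "(\<lambda>x. indicator K x *\<^sub>R k x) = k"
      using that(2) by (force simp: indicator_def)
    finally show ?thesis .
  qed
  have "(LINT x|lborel. f x * d x + g x * \<phi> x) = 0"
  proof (rule integral_directional_derivative_eq_0[where g = "\<lambda>x. f x * \<phi> x" and e = i])
    show "bounded {x. f x * \<phi> x \<noteq> 0}"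
      by (rule bounded_subset[OF compact_imp_bounded[OF K(1)]]) (use \<phi>0 in auto)
    show "((\<lambda>t. f (x + t *\<^sub>R i) * \<phi> (x + t *\<^sub>R i)) has_real_derivative f x * d x + g x * \<phi> x) (at 0)"
      for x
    proof (cases "x \<in> U")
      case True
      from DERIV_mult[OF deriv[OF True] \<phi>_deriv[of x]] show ?thesis
        by (simp add: algebra_simps)
    next
      \<comment> \<open>Here \<open>f\<close> has no known derivative, but the product is zero on
        the line near \<open>x\<close> because the complement of \<open>K\<close> is open.\<close>
      case False
      then have "x \<notin> K" using K by auto
      then have "eventually (\<lambda>t. f (x + t *\<^sub>R i) * \<phi> (x + t *\<^sub>R i) = 0) (nhds 0)"
        by (intro eventually_mono[OF ev0]) auto
      then show ?thesis
        using \<open>x \<notin> K\<close> \<phi>0 d0 by (subst DERIV_cong_ev[OF refl _ refl, where g = "\<lambda>_. 0"]) auto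
    qed
  qed (rule cont(1), rule continuous_on_add[OF cont(2,3)])
  moreover have "(LINT x|lborel. f x * d x + g x * \<phi> x)
      = (LINT x|lborel. f x * d x) + (LINT x|lborel. g x * \<phi> x)"
    by (intro Bochner_Integration.integral_add int cont) (auto simp: \<phi>0 d0)
  moreover have "(LINT x|lebesgue_on U. f x * d x) = (LINT x|lborel. f x * d x)"
    "(LINT x|lebesgue_on U. g x * \<phi> x) = (LINT x|lborel. g x * \<phi> x)"
    using U K(3) \<phi>0 d0
    by (intro integral_lebesgue_on_eq_lborel borel_measurable_continuous_onI cont; force)+
  ultimately show "(LINT x|lebesgue_on U. f x * frechet_derivative \<phi> (at x) i)
      = - (LINT x|lebesgue_on U. g x * \<phi> x)"
    by (simp add: d_def)
qed

text \<open>A bounded open set has finite measure, so the constant \<open>B\<^sup>2\<close> is an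
  integrable bound.\<close>

lemma bounded_continuous_in_L2_on:
  assumes U: "open U" "bounded U" and f: "continuous_on U f"
    and B: "\<And>x. x \<in> U \<Longrightarrow> \<bar>f x\<bar> \<le> B"
  shows "f \<in> L2_on U"
proof -
  have meas: "f \<in> borel_measurable (lebesgue_on U)"
    using U f by (intro continuous_imp_measurable_on_sets_lebesgue) auto
  have "emeasure (lebesgue_on U) (space (lebesgue_on U)) < \<infinity>"
    using U emeasure_bounded_finite[OF U(2)] by (simp add: emeasure_restrict_space)
  then have "finite_measure (lebesgue_on U)"
    by (intro finite_measureI) auto
  then interpret finite_measure "lebesgue_on U" .
  have "integrable (lebesgue_on U) (\<lambda>x. (f x)\<^sup>2)"
  proof (rule integrable_const_bound[where B = "B\<^sup>2"])
    show "AE x in lebesgue_on U. norm ((f x)\<^sup>2) \<le> B\<^sup>2"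
      using power_mono[OF B, of _ 2] by (intro AE_I2) simp
  qed (use meas in measurable)
  with meas show ?thesis by (simp add: L2_on_def)
qed

subsection \<open>The function on the pyramid\<close>

text \<open>Division by zero makes the case distinction at the apex redundant.\<close>

lemma pyramid_u_eq:
  "pyramid_u x = x $ 1 * x $ 3 * (x $ 1 + x $ 3 - 1) * (x $ 2 + x $ 3 - 1) / (1 - x $ 3)"
  by (simp add: pyramid_u_def apex_def)

text \<open>A small upward move from an interior point stays in the pyramid, whose third coordinate
  is at most 1. Hence the denominator of \<open>pyramid_u\<close> has no zero in the
  interior.\<close>

lemma interior_pyramid_below_apex:
  assumes "x \<in> interior pyramid"
  shows "x $ 3 < 1"
proof -
  obtain e where e: "e > 0" "cball x e \<subseteq> pyramid"
    using assms by (auto simp: mem_interior_cball)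
  have "x + e *\<^sub>R axis 3 1 \<in> cball x e"
    using e by (simp add: dist_norm)
  then have "x + e *\<^sub>R axis 3 1 \<in> pyramid" using e by auto
  then show ?thesis using e by (auto simp: pyramid_def axis_def)
qed

lemma bounded_pyramid: "bounded pyramid"
proof (rule bounded_subset)
  show "pyramid \<subseteq> cbox 0 1"
    by (auto simp: pyramid_def mem_box_cart forall_3)
qed simp

text \<open>Each quotient is kept as a factor \<open>s\<close> or \<open>r\<close>, which stays
  bounded near the apex although the denominator tends to 0. Boundedness can then be read off factor
  by factor.\<close>

definition pyramid_u_partial :: "3 \<Rightarrow> real ^ 3 \<Rightarrow> real" where
  "pyramid_u_partial k x =
    (let s = x $ 1 / (1 - x $ 3); r = (x $ 2 + x $ 3 - 1) / (1 - x $ 3); q = x $ 1 + x $ 3 - 1 in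
      if k = 1 then x $ 3 * (x $ 1 + q) * r
      else if k = 2 then s * x $ 3 * q
      else s * q * (x $ 2 + x $ 3 - 1) + s * x $ 3 * (x $ 2 + x $ 3 - 1)
        + s * x $ 3 * q + s * x $ 3 * q * r)"

lemma pyramid_u_has_partial:
  assumes "x $ 3 < 1"
  shows "((\<lambda>t. pyramid_u (x + t *\<^sub>R axis k 1)) has_real_derivative pyramid_u_partial k x) (at 0)"
proof -
  have nz: "1 - x $ 3 \<noteq> 0" using assms by simp
  consider "k = 1" | "k = 2" | "k = 3" using exhaust_3 by blast
  then show ?thesis
  proof cases
    case 1
    then show ?thesis
      using nz unfolding pyramid_u_eq pyramid_u_partial_def Let_def
      by (auto simp: axis_def intro!: derivative_eq_intros) (simp add: algebra_simps)
  next
    case 2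
    then show ?thesis
      using nz unfolding pyramid_u_eq pyramid_u_partial_def Let_def
      by (auto simp: axis_def intro!: derivative_eq_intros)
  next
    case 3
    \<comment> \<open>The third coordinate occurs in numerator and denominator. The quotient rule
      gives one fraction, which is then split into four summands: three from the numerator factors,
      one from the denominator.\<close>
    define a b c where "a = x $ 1" and "b = x $ 2" and "c = x $ 3"
    have "c \<noteq> 1" using nz by (simp add: c_def)
    then have "((\<lambda>t. a * (c + t) * (a + (c + t) - 1) * (b + (c + t) - 1) / (1 - (c + t)))
        has_real_derivative
          ((a * (a + c - 1) * (b + c - 1) + a * c * (b + c - 1) + a * c * (a + c - 1)) * (1 - c)
            + a * c * (a + c - 1) * (b + c - 1)) / (1 - c)\<^sup>2) (at 0)"
      by (auto intro!: derivative_eq_intros simp: power2_eq_square) (simp add: algebra_simps)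
    also have "((a * (a + c - 1) * (b + c - 1) + a * c * (b + c - 1) + a * c * (a + c - 1)) * (1 - c)
          + a * c * (a + c - 1) * (b + c - 1)) / (1 - c)\<^sup>2 = pyramid_u_partial k x"
      using 3 \<open>c \<noteq> 1\<close>
      by (simp add: pyramid_u_partial_def Let_def a_def[symmetric] b_def[symmetric] c_def[symmetric]
          add_divide_distrib power2_eq_square distrib_right)
    finally show ?thesis
      using 3 by (simp add: pyramid_u_eq a_def b_def c_def axis_def)
  qed
qed

section \<open>Bounded partial derivatives and membership in \<open>H1_on\<close>\<close>

lemma continuous_on_pyramid_u_partial:
  "continuous_on (interior pyramid) (pyramid_u_partial k)"
proof -
  have "\<And>x. x \<in> interior pyramid \<Longrightarrow> 1 - x $ 3 \<noteq> 0"
    using interior_pyramid_below_apex by fastforce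
  then show ?thesis
    unfolding pyramid_u_partial_def Let_def
    by (cases "k = 1"; cases "k = 2") (auto intro!: continuous_intros)
qed

lemma abs_mult_le_1:
  fixes a b :: "'a::linordered_idom"
  assumes "\<bar>a\<bar> \<le> 1" "\<bar>b\<bar> \<le> 1"
  shows "\<bar>a * b\<bar> \<le> 1"
  using mult_mono[OF assms] by (simp add: abs_mult)

text \<open>Every factor is at most 1 in absolute value; 4 counts the summands of the derivative in
  the third direction.\<close>

lemma abs_pyramid_u_partial_le:
  assumes "x \<in> interior pyramid"
  shows "\<bar>pyramid_u_partial k x\<bar> \<le> 4"
proof -
  define a b c where "a = x $ 1" and "b = x $ 2" and "c = x $ 3"
  have h: "0 \<le> a" "0 \<le> b" "0 \<le> c" "a \<le> 1 - c" "b \<le> 1 - c"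
    using assms interior_subset[of pyramid] by (auto simp: pyramid_def a_def b_def c_def)
  have c: "c < 1" using interior_pyramid_below_apex[OF assms] by (simp add: c_def)
  define s r q where "s = a / (1 - c)" and "r = (b + c - 1) / (1 - c)" and "q = a + c - 1"
  have 1: "\<bar>s\<bar> \<le> 1" "\<bar>r\<bar> \<le> 1" "\<bar>q\<bar> \<le> 1" "\<bar>b + c - 1\<bar> \<le> 1" "\<bar>c\<bar> \<le> 1" "\<bar>a + q\<bar> \<le> 1"
    using h c by (auto simp: s_def r_def q_def abs_le_iff divide_simps)
  have "\<bar>s * q * (b + c - 1)\<bar> \<le> 1" "\<bar>s * c * (b + c - 1)\<bar> \<le> 1" "\<bar>s * c * q\<bar> \<le> 1"
    "\<bar>s * c * q * r\<bar> \<le> 1" "\<bar>c * (a + q) * r\<bar> \<le> 1"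
    by (intro abs_mult_le_1 1)+
  then show ?thesis
    unfolding pyramid_u_partial_def Let_def a_def[symmetric] b_def[symmetric] c_def[symmetric]
      s_def[symmetric] r_def[symmetric] q_def[symmetric]
    by auto
qed

lemma pyramid_u_in_H1: "pyramid_u \<in> H1_on (interior pyramid)"
proof -
  let ?U = "interior pyramid"
  have U: "open ?U" "bounded ?U"
    using bounded_pyramid bounded_subset interior_subset by (auto intro: bounded_interior)
  have cont: "continuous_on ?U pyramid_u"
    using continuous_on_pyramid_u interior_subset by (rule continuous_on_subset)
  have "\<bar>pyramid_u x\<bar> \<le> 1" if "x \<in> ?U" for x
  proof -
    have "x \<in> pyramid" using that interior_subset by auto
    from abs_pyramid_u_le[OF this] this show ?thesis by (auto simp: pyramid_def)
  qed
  then have "pyramid_u \<in> L2_on ?U"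
    by (rule bounded_continuous_in_L2_on[OF U cont])
  moreover have "\<exists>g\<in>L2_on ?U. weak_partial_derivative_on ?U i pyramid_u g" if i: "i \<in> Basis" for i
  proof -
    obtain k where k: "i = axis k 1" using i by (auto simp: Basis_vec_def)
    have "pyramid_u_partial k \<in> L2_on ?U"
      using U continuous_on_pyramid_u_partial abs_pyramid_u_partial_le
      by (rule bounded_continuous_in_L2_on)
    moreover have "weak_partial_derivative_on ?U i pyramid_u (pyramid_u_partial k)"
      using i unfolding k
      by (intro weak_partial_derivative_onI U cont continuous_on_pyramid_u_partial
          pyramid_u_has_partial interior_pyramid_below_apex)
    ultimately show ?thesis by blast
  qed
  ultimately show ?thesis by (simp add: H1_on_def)
qed

section \<open>Values on the faces\<close>

lemma pyramid_u_polynomial_on_faces: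
  assumes "F \<in> pyramid_faces"
  shows "\<exists>p. real_polynomial_function p \<and> (\<forall>x\<in>F. pyramid_u x = p x)"
proof (cases "F = pyramid \<inter> {x. x $ 2 = 0}")
  case True
  \<comment> \<open>For \<open>x $ 2 = 0\<close> the last factor of the numerator cancels the
    denominator up to sign.\<close>
  let ?p = "\<lambda>x::real^3. - (x $ 1 * x $ 3 * (x $ 1 + x $ 3 - 1))"
  have "real_polynomial_function ?p"
    by (intro real_polynomial_function_minus real_polynomial_function_diff
        real_polynomial_function.intros bounded_linear_vec_nth)
  moreover have "pyramid_u x = ?p x" if "x \<in> F" for x
    using that pyramid_eq_apex_iff[of x] unfolding True
    by (cases "x = apex") (auto simp: pyramid_u_eq divide_simps apex_def algebra_simps)
  ultimately show ?thesis by blast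
next
  case False
  \<comment> \<open>On each remaining face one factor of the numerator vanishes.\<close>
  then have "\<forall>x\<in>F. pyramid_u x = 0"
    using assms by (auto simp: pyramid_faces_def pyramid_u_eq)
  then show ?thesis
    using real_polynomial_function.intros(2) by blast
qed

subsection \<open>Second-order expansion of polynomials on lines\<close>

text \<open>This is the second-order Taylor expansion of \<open>p\<close> at \<open>x\<close>, with
  \<open>L\<close> and \<open>B\<close> shared by all directions \<open>v\<close>. The coefficients
  of order 0 and 1 are carried along because the product case needs them for order 2.\<close>

lemma real_polynomial_function_line_expansion:
  fixes p :: "'a::real_normed_vector \<Rightarrow> real"
  assumes "real_polynomial_function p"
  shows "\<exists>P c L B. linear L \<and> bilinear B \<and> (\<forall>v t. p (x + t *\<^sub>R v) = poly (P v) t) \<and>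
    (\<forall>v. coeff (P v) 0 = c \<and> coeff (P v) 1 = L v \<and> coeff (P v) 2 = B v v)"
  using assms
proof induction
  case (linear f)
  then interpret bounded_linear f .
  have "linear f \<and> bilinear (\<lambda>_ _. 0 :: real) \<and> (\<forall>v t. f (x + t *\<^sub>R v) = poly [:f x, f v:] t) \<and>
    (\<forall>v. coeff [:f x, f v:] 0 = f x \<and> coeff [:f x, f v:] 1 = f v \<and> coeff [:f x, f v:] 2 = 0)"
    by (simp add: add scaleR numeral_2_eq_2 bilinear_def linear_axioms linear_zero)
  then show ?case
    by (intro exI[of _ "\<lambda>v. [:f x, f v:]"] exI[of _ "f x :: real"] exI[of _ "f :: _ \<Rightarrow> real"]
        exI[of _ "(\<lambda>_ _. 0) :: _ \<Rightarrow> _ \<Rightarrow> real"]) simp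
next
  case (const c)
  have "linear (\<lambda>_. 0 :: real) \<and> bilinear (\<lambda>_ _. 0 :: real) \<and> (\<forall>v t. c = poly [:c:] t) \<and>
    (\<forall>v. coeff [:c:] 0 = c \<and> coeff [:c:] 1 = 0 \<and> coeff [:c:] 2 = 0)"
    by (simp add: numeral_2_eq_2 bilinear_def linear_zero)
  then show ?case
    by (intro exI[of _ "\<lambda>_. [:c:]"] exI[of _ "c :: real"] exI[of _ "(\<lambda>_. 0) :: _ \<Rightarrow> real"]
        exI[of _ "(\<lambda>_ _. 0) :: _ \<Rightarrow> _ \<Rightarrow> real"]) simp
next
  case (add f g)
  from add.IH obtain P c L B P' c' L' B' where
    P: "\<And>v t. f (x + t *\<^sub>R v) = poly (P v) t" "\<And>v t. g (x + t *\<^sub>R v) = poly (P' v) t"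
      "\<And>v. coeff (P v) 0 = c" "\<And>v. coeff (P v) 1 = L v" "\<And>v. coeff (P v) 2 = B v v"
      "\<And>v. coeff (P' v) 0 = c'" "\<And>v. coeff (P' v) 1 = L' v" "\<And>v. coeff (P' v) 2 = B' v v"
    and lin: "linear L" "bilinear B" "linear L'" "bilinear B'"
    by metis
  have "linear (\<lambda>v. L v + L' v)" "bilinear (\<lambda>v w. B v w + B' v w)"
    using lin by (auto simp: bilinear_def intro: linear_compose_add)
  moreover have "f (x + t *\<^sub>R v) + g (x + t *\<^sub>R v) = poly (P v + P' v) t" for v t
    by (simp add: P)
  moreover have "coeff (P v + P' v) 0 = c + c'" "coeff (P v + P' v) 1 = L v + L' v"
    "coeff (P v + P' v) 2 = B v v + B' v v" for v
    by (simp_all only: coeff_add P)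
  ultimately show ?case
    by (intro exI[of _ "\<lambda>v. P v + P' v"] exI[of _ "c + c' :: real"]
        exI[of _ "(\<lambda>v. L v + L' v) :: _ \<Rightarrow> real"]
        exI[of _ "(\<lambda>v w. B v w + B' v w) :: _ \<Rightarrow> _ \<Rightarrow> real"]) simp
next
  case (mult f g)
  from mult.IH obtain P c L B P' c' L' B' where
    P: "\<And>v t. f (x + t *\<^sub>R v) = poly (P v) t" "\<And>v t. g (x + t *\<^sub>R v) = poly (P' v) t"
      "\<And>v. coeff (P v) 0 = c" "\<And>v. coeff (P v) 1 = L v" "\<And>v. coeff (P v) 2 = B v v"
      "\<And>v. coeff (P' v) 0 = c'" "\<And>v. coeff (P' v) 1 = L' v" "\<And>v. coeff (P' v) 2 = B' v v"
    and lin: "linear L" "bilinear B" "linear L'" "bilinear B'"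
    by metis
  have coeffs: "coeff (A * A') 0 = coeff A 0 * coeff A' 0"
    "coeff (A * A') 1 = coeff A 0 * coeff A' 1 + coeff A 1 * coeff A' 0"
    "coeff (A * A') 2 = coeff A 0 * coeff A' 2 + coeff A 1 * coeff A' 1 + coeff A 2 * coeff A' 0"
    for A A' :: "real poly"
    by (simp_all add: coeff_mult numeral_2_eq_2)
  \<comment> \<open>The order-2 coefficient of a product contains \<open>L v * L' v\<close>, the
    diagonal of the bilinear map \<open>L v * L' w\<close>.\<close>
  have "linear (\<lambda>v. c * L' v + L v * c')"
    "bilinear (\<lambda>v w. c * B' v w + L v * L' w + B v w * c')"
    using lin by (simp_all add: bilinear_def linear_iff algebra_simps)
  moreover have "f (x + t *\<^sub>R v) * g (x + t *\<^sub>R v) = poly (P v * P' v) t" for v t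
    by (simp add: P)
  moreover have "coeff (P v * P' v) 0 = c * c'" "coeff (P v * P' v) 1 = c * L' v + L v * c'"
    "coeff (P v * P' v) 2 = c * B' v v + L v * L' v + B v v * c'" for v
    by (simp_all only: coeffs P)
  ultimately show ?case
    by (intro exI[of _ "\<lambda>v. P v * P' v"] exI[of _ "c * c' :: real"]
        exI[of _ "(\<lambda>v. c * L' v + L v * c') :: _ \<Rightarrow> real"]
        exI[of _ "(\<lambda>v w. c * B' v w + L v * L' w + B v w * c') :: _ \<Rightarrow> _ \<Rightarrow> real"]) simp
qed

section \<open>Non-existence of a polynomial with the face values of
  \<open>pyramid_u\<close>\<close>

lemma poly_eqI_on_unit_interval:
  fixes A B :: "real poly"
  assumes "\<And>t. 0 < t \<Longrightarrow> t < 1 \<Longrightarrow> poly A t = poly B t"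
  shows "A = B"
proof (rule ccontr)
  assume "A \<noteq> B"
  then have "finite {t. poly (A - B) t = 0}"
    by (intro poly_roots_finite) simp
  moreover have "{0<..<1} \<subseteq> {t. poly (A - B) t = 0}"
    using assms by auto
  ultimately have "finite {0<..<1::real}"
    by (rule finite_subset[rotated])
  then show False
    by (simp add: infinite_Ioo)
qed

text \<open>From the apex, a direction \<open>(a, b, -1)\<close> in the unit square of pairs
  \<open>(a, b)\<close>, with \<open>a\<close> or \<open>b\<close> in \<open>{0, 1}\<close>, runs
  inside a lateral face, so \<open>pyramid_u\<close> fixes the order-2 coefficient of
  \<open>p\<close> there. This is a quadratic form with six unknown coefficients, and seven
  directions give inconsistent linear equations.\<close>

lemma no_polynomial_agrees_on_faces:
  assumes p: "real_polynomial_function p"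
    and agree: "\<And>F x. F \<in> pyramid_faces \<Longrightarrow> x \<in> F \<Longrightarrow> p x = pyramid_u x"
  shows False
proof -
  obtain P B where P: "\<And>v t. p (apex + t *\<^sub>R v) = poly (P v) t"
    and B: "bilinear B" "\<And>v. coeff (P v) 2 = B v v"
    using real_polynomial_function_line_expansion[OF p, of apex] by metis
  define e1 e2 e3 :: "real ^ 3" where "e1 = axis 1 1" and "e2 = axis 2 1" and "e3 = axis 3 1"
  \<comment> \<open>\<open>B\<close> is not known to be symmetric, so each mixed coefficient adds
    both orders.\<close>
  define q11 q12 q13 q22 q23 q33 where "q11 = B e1 e1" and "q12 = B e1 e2 + B e2 e1"
    and "q13 = B e1 e3 + B e3 e1" and "q22 = B e2 e2" and "q23 = B e2 e3 + B e3 e2" and "q33 = B e3 e3"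
  have q: "coeff (P (vector [a, b, -1])) 2
      = q11 * a\<^sup>2 + q12 * (a * b) - q13 * a + q22 * b\<^sup>2 - q23 * b + q33" for a b
  proof -
    have v: "vector [a, b, -1] = a *\<^sub>R e1 + b *\<^sub>R e2 - e3"
      by (simp add: vec_eq_iff forall_3 axis_def e1_def e2_def e3_def)
    then show ?thesis
      unfolding B(2) v q11_def q12_def q13_def q22_def q23_def q33_def
      by (simp add: B(1) bilinear_ladd bilinear_radd bilinear_lsub bilinear_rsub bilinear_lmul
          bilinear_rmul power2_eq_square algebra_simps)
  qed
  \<comment> \<open>The parameter \<open>t\<close> is the depth below the apex, and
    \<open>a\<close>, \<open>b\<close> are the first two coordinates divided by it.\<close>
  have comp: "(apex + t *\<^sub>R vector [a, b, -1]) $ 1 = t * a"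
    "(apex + t *\<^sub>R vector [a, b, -1]) $ 2 = t * b"
    "(apex + t *\<^sub>R vector [a, b, -1]) $ 3 = 1 - t" for t a b :: real
    by (simp_all add: apex_def)
  have val: "poly (P (vector [a, b, -1])) t = t * a * (1 - t) * (t * a - t) * (t * b - t) / t"
    if t: "0 < t" "t < 1" and ab: "0 \<le> a" "a \<le> 1" "0 \<le> b" "b \<le> 1"
      and face: "a = 0 \<or> a = 1 \<or> b = 0 \<or> b = 1" for a b t
  proof -
    let ?x = "apex + t *\<^sub>R vector [a, b, -1]"
    have "?x \<in> pyramid"
      using t ab by (simp add: pyramid_def comp mult_left_le del: vector_add_component vector_scaleR_component)
    then have "\<exists>F\<in>pyramid_faces. ?x \<in> F"
      using face by (auto simp: pyramid_faces_def comp simp del: vector_add_component vector_scaleR_component)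
    then have "p ?x = pyramid_u ?x" using agree by blast
    then show ?thesis unfolding pyramid_u_eq comp P by simp
  qed
  \<comment> \<open>The edge \<open>b = 0\<close> is left out: for \<open>0 < a < 1\<close> the
    formula in \<open>val\<close> is nonzero there.\<close>
  have zero: "coeff (P (vector [a, b, -1])) 2 = 0"
    if "0 \<le> a" "a \<le> 1" "0 \<le> b" "b \<le> 1" "a = 0 \<or> a = 1 \<or> b = 1" for a b
  proof -
    have "P (vector [a, b, -1]) = 0"
      by (rule poly_eqI_on_unit_interval) (use that val[of _ a b] in auto)
    then show ?thesis by simp
  qed
  \<comment> \<open>On the midline of the face \<open>x $ 2 = 0\<close> the function is
    \<open>t\<^sup>2 * (1 - t) / 4\<close>.\<close>
  have "P (vector [1/2, 0, -1]) = [:0, 0, 1/4, -1/4:]"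
    by (rule poly_eqI_on_unit_interval) (simp add: val field_simps power2_eq_square)
  then have "coeff (P (vector [1/2, 0, -1])) 2 = 1/4"
    by (simp add: numeral_2_eq_2)
  then have "q11 / 4 - q13 / 2 + q33 = 1/4"
    unfolding q by (simp add: power2_eq_square)
  \<comment> \<open>The directions are the four corners of the square of pairs \<open>(a, b)\<close>
    and the midpoints of its edges \<open>a = 0\<close> and \<open>b = 1\<close>. Together they
    force all six coefficients to be zero.\<close>
  moreover have "q33 = 0" "q22 / 4 - q23 / 2 + q33 = 0" "q22 - q23 + q33 = 0"
    "q11 - q13 + q33 = 0" "q11 + q12 - q13 + q22 - q23 + q33 = 0"
    "q11 / 4 + q12 / 2 - q13 / 2 + q22 - q23 + q33 = 0"
    using zero[of 0 0] zero[of 0 "1/2"] zero[of 0 1] zero[of 1 0] zero[of 1 1] zero[of "1/2" 1]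
    unfolding q by (simp_all add: power2_eq_square)
  ultimately show False by linarith
qed

theorem theorem1p1:
  shows "pyramid_u \<in> H1_on (interior pyramid)
    \<and> (\<forall>F\<in>pyramid_faces. \<exists>p. real_polynomial_function p \<and> (\<forall>x\<in>F. pyramid_u x = p x))
    \<and> \<not> (\<exists>p. real_polynomial_function p \<and> (\<forall>F\<in>pyramid_faces. \<forall>x\<in>F. p x = pyramid_u x))"
  using pyramid_u_in_H1 pyramid_u_polynomial_on_faces no_polynomial_agrees_on_faces by blast

end
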